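(* Let $(\mathfrak g,\omega)$ be a filiform nilpotent symplectic Lie algebra of dimension $n=2\ell$. Then $C^{\ell-1}\mathfrak g$ is a Lagrangian ideal. Moreover, $C^{\ell-1}\mathfrak g$ is the only Lagrangian ideal in $(\mathfrak g,\omega)$.
   Context: All Lie algebras are finite-dimensional over a fixed field of characteristic $0$. A symplectic Lie algebra $(\mathfrak g,\omega)$ is a Lie algebra with a non-degenerate alternating form $\omega$ satisfying $\omega([u,v],w)+\omega([w,u],v)+\omega([v,w],u)=0$ for all $u,v,w\in\mathfrak g$. The descending central series is $C^0\mathfrak g=\mathfrak g$, $C^{i+1}\mathfrak g=[\mathfrak g,C^i\mathfrak g]$; $\mathfrak g$ has nilpotency class $m$ if $C^m\mathfrak g=0$ and $C^{m-1}\mathfrak g\ne0$. A nilpotent Lie algebra of dimension $n$ is called filiform if its nilpotency class is maximal relative to its dimension, that is, if it is of nilpotency class $n-1$; then $\dim C^i\mathfrak g=n-i-1$ for $1\le i\le n-1$. A Lagrangian ideal of $(\mathfrak g,\omega)$ is an ideal of $\mathfrak g$ which is a maximal isotropic subspace for $\omega$ (equivalently, which equals its $\omega$-orthogonal).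
   Formalization: The theorem is proved for ℓ ≥ 2; for n = 2 the claim fails, since the abelian plane is filiform of class 1 under the stated definition, yet C^0 g = g is not isotropic and every line is a Lagrangian ideal. *)

theory Defs
  imports Complex_Main
begin

locale lie_algebra = vector_space scale
  for scale :: "'k::field_char_0 \<Rightarrow> 'v::ab_group_add \<Rightarrow> 'v" +
  fixes bracket :: "'v \<Rightarrow> 'v \<Rightarrow> 'v"
  assumes finite_dim: "\<exists>B. finite B \<and> span B = UNIV"
    and bracket_linear_left: "Vector_Spaces.linear scale scale (\<lambda>u. bracket u v)"
    and bracket_linear_right: "Vector_Spaces.linear scale scale (\<lambda>v. bracket u v)"
    and bracket_self: "bracket u u = 0"
    and jacobi: "bracket u (bracket v w) + bracket v (bracket w u) + bracket w (bracket u v) = 0"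
begin

fun descending_central :: "nat \<Rightarrow> 'v set" where
  "descending_central 0 = UNIV"
| "descending_central (Suc i) = span {bracket u v |u v. v \<in> descending_central i}"

definition nilpotent :: bool where
  "nilpotent \<longleftrightarrow> (\<exists>m. descending_central m = {0})"

text \<open>The condition \<^term>\<open>m \<ge> 1\<close> makes \<^term>\<open>m - 1\<close> meaningful; the zero algebra has no
  nilpotency class in this sense.\<close>
definition has_nilpotency_class :: "nat \<Rightarrow> bool" where
  "has_nilpotency_class m \<longleftrightarrow>
     m \<ge> 1 \<and> descending_central m = {0} \<and> descending_central (m - 1) \<noteq> {0}"

definition filiform :: bool where
  "filiform \<longleftrightarrow> nilpotent \<and> has_nilpotency_class (dim UNIV - 1)"

definition lie_ideal :: "'v set \<Rightarrow> bool" where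
  "lie_ideal I \<longleftrightarrow> subspace I \<and> (\<forall>u. \<forall>v\<in>I. bracket u v \<in> I)"

end

locale symplectic_lie_algebra = lie_algebra scale bracket
  for scale :: "'k::field_char_0 \<Rightarrow> 'v::ab_group_add \<Rightarrow> 'v"
    and bracket :: "'v \<Rightarrow> 'v \<Rightarrow> 'v" +
  fixes \<omega> :: "'v \<Rightarrow> 'v \<Rightarrow> 'k"
  assumes form_linear_left: "Vector_Spaces.linear scale (*) (\<lambda>u. \<omega> u v)"
    and form_linear_right: "Vector_Spaces.linear scale (*) (\<lambda>v. \<omega> u v)"
    and form_alternating: "\<omega> u u = 0"
    and form_nondegenerate: "(\<And>v. \<omega> u v = 0) \<Longrightarrow> u = 0"
    and form_closed: "\<omega> (bracket u v) w + \<omega> (bracket w u) v + \<omega> (bracket v w) u = 0"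
begin

definition isotropic :: "'v set \<Rightarrow> bool" where
  "isotropic U \<longleftrightarrow> subspace U \<and> (\<forall>u\<in>U. \<forall>v\<in>U. \<omega> u v = 0)"

definition lagrangian_ideal :: "'v set \<Rightarrow> bool" where
  "lagrangian_ideal I \<longleftrightarrow>
     lie_ideal I \<and> isotropic I \<and> (\<forall>W. isotropic W \<and> I \<subseteq> W \<longrightarrow> W = I)"

end

end

theory Submission
  imports Defs
begin

text \<open>Modulo an ideal \<open>I\<close>, the descending central series drops by at least two dimensions in its
  first step and by at least one in every later step, until it vanishes. Hence an ideal of
  codimension \<open>k \<ge> 2\<close> contains \<open>C\<^sup>k\<^sup>-\<^sup>1\<close>. Closedness of the form together with
  \<open>[C\<^sup>i, C\<^sup>j] \<subseteq> C\<^sup>i\<^sup>+\<^sup>j\<^sup>+\<^sup>1\<close> gives \<open>\<omega>(C\<^sup>i, C\<^sup>j) = 0\<close> for \<open>i + j \<ge> n - 1\<close>; so \<open>C\<^sup>l\<^sup>-\<^sup>1\<close> is orthogonal to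
  its hyperplane \<open>C\<^sup>l\<close>, and therefore isotropic, of the maximal possible dimension \<open>l\<close>. A Lagrangian
  ideal has codimension \<open>l\<close>, so it contains \<open>C\<^sup>l\<^sup>-\<^sup>1\<close> and by maximality equals it.\<close>

section \<open>Finite dimension and bilinearity of the bracket\<close>

context lie_algebra
begin

text \<open>The locale \<open>finite_dimensional_vector_space\<close> takes a basis as a parameter;
  \<open>extend_basis {}\<close> is a closed term for one, so the sublocale below needs no extra
  assumption.\<close>

lemma finite_dimensional_extend_basis:
  "finite_dimensional_vector_space scale (extend_basis {})"
proof unfold_locales
  have ind: "independent (extend_basis {})"
    using independent_empty by (rule independent_extend_basis)
  show "\<not> dependent (extend_basis {})" by fact
  show "span (extend_basis {}) = UNIV"
    using independent_empty by (rule span_extend_basis)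
  obtain B where "finite B" "span B = UNIV" using finite_dim by blast
  then show "finite (extend_basis {})"
    using independent_span_bound[OF _ ind] by blast
qed

sublocale finite_dimensional_vector_space scale "extend_basis {}"
  by (rule finite_dimensional_extend_basis)

declare dim_UNIV [simp del] descending_central.simps(2) [simp del]

lemma bracket_add_left: "bracket (u + v) w = bracket u w + bracket v w"
  using bracket_linear_left[of w] by (simp add: Vector_Spaces.linear_iff)

lemma bracket_add_right: "bracket w (u + v) = bracket w u + bracket w v"
  using bracket_linear_right[of w] by (simp add: Vector_Spaces.linear_iff)

lemma bracket_scale_right: "bracket w (scale c u) = scale c (bracket w u)"
  using bracket_linear_right[of w] by (simp add: Vector_Spaces.linear_iff)

lemma bracket_zero_right [simp]: "bracket w 0 = 0"
  using bracket_add_right[where u = 0 and v = 0 and w = w] by simp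

lemma bracket_skew: "bracket u v = - bracket v u"
proof -
  have "bracket u v + bracket v u = 0"
    using bracket_self[of "u + v"] bracket_self[of u] bracket_self[of v]
    by (simp add: bracket_add_left bracket_add_right add.commute)
  then show ?thesis by (simp add: add_eq_0_iff2)
qed

lemma bracket_span_right:
  assumes "subspace T" "\<And>v. v \<in> S \<Longrightarrow> bracket u v \<in> T" "v \<in> span S"
  shows "bracket u v \<in> T"
  using assms(3)
proof (rule span_induct)
  show "subspace {v. bracket u v \<in> T}"
    using assms(1) by (simp add: subspace_def bracket_add_right bracket_scale_right)
qed (use assms(2) in auto)

lemma bracket_span_left:
  assumes "subspace T" "\<And>u. u \<in> S \<Longrightarrow> bracket u v \<in> T" "u \<in> span S"
  shows "bracket u v \<in> T"
  using bracket_span_right[of T S v u] assms bracket_skew subspace_neg by metis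

section \<open>The descending central series\<close>

lemma subspace_descending_central: "subspace (descending_central i)"
  by (cases i) (auto simp: descending_central.simps(2))

lemma bracket_descending_central:
  "v \<in> descending_central i \<Longrightarrow> bracket u v \<in> descending_central (Suc i)"
  by (auto simp: descending_central.simps(2) intro: span_base)

lemma bracket_descending_central_left:
  "u \<in> descending_central i \<Longrightarrow> bracket u v \<in> descending_central (Suc i)"
  using bracket_descending_central bracket_skew subspace_neg subspace_descending_central by metis

lemma descending_central_Suc_subset:
  assumes "\<And>u v. v \<in> descending_central i \<Longrightarrow> bracket u v \<in> T" "subspace T"
  shows "descending_central (Suc i) \<subseteq> T"
  unfolding descending_central.simps(2) using assms by (intro span_minimal) auto

lemma descending_central_Suc_le: "descending_central (Suc i) \<subseteq> descending_central i"
proof (induction i)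
  case (Suc i)
  then show ?case
    using descending_central_Suc_subset[of "Suc i"] bracket_descending_central
      subspace_descending_central by (meson subsetD)
qed simp

lemma descending_central_antimono:
  "i \<le> j \<Longrightarrow> descending_central j \<subseteq> descending_central i"
  by (rule lift_Suc_antimono_le[where f = descending_central]) (rule descending_central_Suc_le)

lemma lie_ideal_descending_central: "lie_ideal (descending_central i)"
  unfolding lie_ideal_def
  using subspace_descending_central bracket_descending_central descending_central_Suc_le by blast

lemma lie_ideal_zero: "lie_ideal {0}"
  by (simp add: lie_ideal_def)

text \<open>Jacobi rewrites \<open>[[a, b], v]\<close> as \<open>[a, [b, v]] + [b, [v, a]]\<close>.
  Both terms only need the induction hypothesis for \<open>b\<close>, with \<open>j\<close> or
  \<open>Suc j\<close>; hence \<open>j\<close> is arbitrary.\<close>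

lemma bracket_descending_central_both:
  assumes "u \<in> descending_central i" "v \<in> descending_central j"
  shows "bracket u v \<in> descending_central (i + j + 1)"
  using assms
proof (induction i arbitrary: u v j)
  case 0
  then show ?case using bracket_descending_central by simp
next
  case (Suc i)
  let ?T = "descending_central (Suc i + j + 1)"
  have T: "subspace ?T" by (rule subspace_descending_central)
  have "bracket (bracket a b) v \<in> ?T" if b: "b \<in> descending_central i" for a b
  proof -
    have "bracket a (bracket b v) \<in> ?T"
      using Suc.IH[OF b Suc.prems(2)] bracket_descending_central by fastforce
    moreover have "bracket v a \<in> descending_central (Suc j)"
      using Suc.prems(2) by (rule bracket_descending_central_left)
    then have "bracket b (bracket v a) \<in> ?T" using Suc.IH[OF b] by fastforce
    ultimately have "bracket a (bracket b v) + bracket b (bracket v a) \<in> ?T"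
      using T by (simp add: subspace_add)
    moreover have "bracket (bracket a b) v = bracket a (bracket b v) + bracket b (bracket v a)"
      using jacobi[of a b v] bracket_skew[of v "bracket a b"] by simp
    ultimately show ?thesis by simp
  qed
  then show ?case
    using bracket_span_left[OF T, of "{bracket a b |a b. b \<in> descending_central i}" v u] Suc.prems(1)
    by (auto simp: descending_central.simps(2))
qed

section \<open>The central series modulo an ideal\<close>

lemma central_stable_step:
  assumes I: "lie_ideal I" and "descending_central i \<subseteq> span (I \<union> descending_central (Suc i))"
  shows "descending_central (Suc i) \<subseteq> span (I \<union> descending_central (Suc (Suc i)))"
proof (rule descending_central_Suc_subset)
  fix u v assume "v \<in> descending_central i"
  then have "v \<in> span (I \<union> descending_central (Suc i))" using assms by blast
  then show "bracket u v \<in> span (I \<union> descending_central (Suc (Suc i)))"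
  proof (rule bracket_span_right[rotated 2])
    fix w assume "w \<in> I \<union> descending_central (Suc i)"
    then show "bracket u w \<in> span (I \<union> descending_central (Suc (Suc i)))"
      using I bracket_descending_central[of w "Suc i" u] unfolding lie_ideal_def
      by (blast intro: span_base)
  qed simp
qed simp

text \<open>If the series stalls modulo \<open>I\<close> once, it stalls from there on, so its
  \<open>i\<close>-th term lies in \<open>I\<close> plus an arbitrarily late term, which nilpotency
  makes zero.\<close>

lemma central_stable_imp_subset:
  assumes "nilpotent" and I: "lie_ideal I"
    and st: "descending_central i \<subseteq> span (I \<union> descending_central (Suc i))"
  shows "descending_central i \<subseteq> I"
proof -
  have st': "descending_central (i + k) \<subseteq> span (I \<union> descending_central (Suc (i + k)))" for k
    by (induction k) (use st central_stable_step[OF I] in auto)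
  have *: "descending_central i \<subseteq> span (I \<union> descending_central (i + k))" for k
  proof (induction k)
    case (Suc k)
    have "span (I \<union> descending_central (i + k)) \<subseteq> span (I \<union> descending_central (Suc (i + k)))"
      using st'[of k] by (intro span_minimal) (auto intro: span_base)
    then show ?case using Suc by auto
  qed (auto intro: span_base)
  obtain m where m: "descending_central m = {0}" using assms(1) nilpotent_def by auto
  have "0 \<in> I" "subspace I" using I by (auto simp: lie_ideal_def subspace_0)
  moreover have "descending_central (i + m) \<subseteq> {0}"
    using m descending_central_antimono[of m "i + m"] by simp
  ultimately have "span (I \<union> descending_central (i + m)) \<subseteq> I" by (intro span_minimal) auto
  then show ?thesis using * by blast
qed

text \<open>A nilpotent quotient whose abelianization has dimension at most 1 is generated by one
  element, hence abelian. Concretely, all brackets fall into \<open>?T\<close>, so the series stalls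
  modulo \<open>I\<close> at index 1.\<close>

lemma derived_subset_ideal:
  assumes "nilpotent" and I: "lie_ideal I"
    and dim: "dim UNIV \<le> dim (span (I \<union> descending_central 1)) + 1"
  shows "descending_central 1 \<subseteq> I"
proof -
  let ?S = "I \<union> descending_central 1"
  let ?T = "span (I \<union> descending_central 2)"
  obtain x where x: "span (insert x ?S) = UNIV"
  proof (cases "span ?S = UNIV")
    case True
    \<comment> \<open>Only spanning matters, so 0 serves when no further generator is
      required.\<close>
    then show ?thesis using that[of 0] by simp
  next
    case False
    then obtain x where "x \<notin> span ?S" by blast
    then have "dim (insert x ?S) = dim ?S + 1" by (simp add: dim_insert)
    then have "span (insert x ?S) = UNIV"
      using dim subspace_dim_equal[of "span (insert x ?S)" UNIV] by simp
    then show ?thesis by (rule that)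
  qed
  have ideal: "bracket u v \<in> ?T" if "u \<in> ?S" for u v
    using that I bracket_descending_central_left[of u 1 v] bracket_skew[of u v]
      subspace_neg[of I "bracket v u"]
    unfolding lie_ideal_def by (auto intro: span_base simp: numeral_2_eq_2)
  then have ideal': "bracket v u \<in> ?T" if "u \<in> ?S" for u v
    using that bracket_skew[of v u] span_neg by metis
  \<comment> \<open>The only pair of generators with no member in \<open>?S\<close> is
    \<open>x\<close> with itself, and \<open>bracket x x = 0\<close>.\<close>
  have gen: "bracket u v \<in> ?T" if "u \<in> insert x ?S" "v \<in> insert x ?S" for u v
    using that ideal ideal' bracket_self span_zero by (metis insertE)
  have "bracket u v \<in> ?T" if "u \<in> insert x ?S" for u v
    using bracket_span_right[of ?T "insert x ?S" u v] gen[OF that] x by simp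
  then have "bracket u v \<in> ?T" for u v
    using bracket_span_left[of ?T "insert x ?S" v u] x by simp
  then have "descending_central 1 \<subseteq> ?T"
    using descending_central_Suc_subset[of 0 ?T] by simp
  then show ?thesis using central_stable_imp_subset[OF assms(1) I, of 1] by (simp add: numeral_2_eq_2)
qed

text \<open>Codimension 2 at the start is the contrapositive of \<open>derived_subset_ideal\<close>;
  each later step loses a dimension because a stall would force containment in
  \<open>I\<close>.\<close>

lemma dim_ideal_plus_central:
  assumes "nilpotent" and I: "lie_ideal I"
    and "i \<ge> 1" and "\<not> descending_central i \<subseteq> I"
  shows "dim (span (I \<union> descending_central i)) + i + 1 \<le> dim UNIV"
  using assms(3,4)
proof (induction i rule: dec_induct)
  case base
  then show ?case using derived_subset_ideal[OF assms(1) I] by fastforce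
next
  case (step i)
  let ?A = "\<lambda>i. span (I \<union> descending_central i)"
  have ni: "\<not> descending_central i \<subseteq> I" using step.prems descending_central_Suc_le by blast
  have sub: "?A (Suc i) \<subseteq> ?A i" using descending_central_Suc_le by (intro span_mono) blast
  have "?A (Suc i) \<noteq> ?A i"
  proof
    assume "?A (Suc i) = ?A i"
    then have "descending_central i \<subseteq> ?A (Suc i)" by (auto intro: span_base)
    then show False using ni central_stable_imp_subset[OF assms(1) I] by blast
  qed
  then have "dim (?A (Suc i)) < dim (?A i)"
    using sub subspace_dim_equal[of "?A (Suc i)" "?A i"] by force
  then show ?case using step.IH[OF ni] by simp
qed

text \<open>Strict descent counted downwards from index \<open>Suc m\<close>, where the bound is
  trivial; the zero ideal turns a stall into vanishing.\<close>

lemma dim_descending_central_ge: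
  assumes "nilpotent" "descending_central m \<noteq> {0}" "i \<le> Suc m"
  shows "Suc m \<le> dim (descending_central i) + i"
  using assms(3)
proof (induction i rule: inc_induct)
  case (step i)
  have "descending_central i \<noteq> descending_central (Suc i)"
  proof
    assume "descending_central i = descending_central (Suc i)"
    then have "descending_central i \<subseteq> {0}"
      using central_stable_imp_subset[OF assms(1) lie_ideal_zero, of i] by (auto intro: span_base)
    then show False
      using assms(2) descending_central_antimono[of i m] step.hyps subspace_0[OF subspace_descending_central] by fastforce
  qed
  then have "dim (descending_central (Suc i)) < dim (descending_central i)"
    using subspace_dim_equal[OF subspace_descending_central subspace_descending_central
        descending_central_Suc_le] by force
  then show ?case using step.IH by simp
qed simp

end

section \<open>The symplectic form: orthogonality, isotropic subspaces and the central
  series\<close>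

context symplectic_lie_algebra
begin

lemma form_add_left: "\<omega> (u + v) w = \<omega> u w + \<omega> v w"
  using form_linear_left[of w] by (simp add: Vector_Spaces.linear_iff)

lemma form_scale_left: "\<omega> (scale c u) w = c * \<omega> u w"
  using form_linear_left[of w] by (simp add: Vector_Spaces.linear_iff)

lemma form_zero_left [simp]: "\<omega> 0 w = 0"
  using form_scale_left[where c = 0 and u = 0 and w = w] by simp

lemma form_add_right: "\<omega> w (u + v) = \<omega> w u + \<omega> w v"
  using form_linear_right[of w] by (simp add: Vector_Spaces.linear_iff)

lemma form_scale_right: "\<omega> w (scale c u) = c * \<omega> w u"
  using form_linear_right[of w] by (simp add: Vector_Spaces.linear_iff)

lemma form_zero_right [simp]: "\<omega> w 0 = 0"
  using form_add_right[where u = 0 and v = 0 and w = w] by simp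

lemma form_span_zero:
  assumes "\<And>b. b \<in> S \<Longrightarrow> \<omega> u b = 0" "v \<in> span S"
  shows "\<omega> u v = 0"
  using assms(2)
proof (rule span_induct)
  show "subspace {v. \<omega> u v = 0}"
    by (simp add: subspace_def form_add_right form_scale_right)
qed (use assms(1) in auto)

lemma form_skew: "\<omega> u v = - \<omega> v u"
proof -
  have "\<omega> u v + \<omega> v u = 0"
    using form_alternating[of "u + v"] form_alternating[of u] form_alternating[of v]
    by (simp add: form_add_left form_add_right add.commute)
  then show ?thesis by (simp add: add_eq_0_iff2)
qed

lemma form_eq_zero_commute: "\<omega> u v = 0 \<longleftrightarrow> \<omega> v u = 0"
  using form_skew[of u v] by simp

text \<open>Each condition \<open>\<omega> w b = 0\<close> is one linear equation and costs at most
  one dimension.\<close>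

lemma dim_le_dim_orthogonal:
  assumes "finite B" "subspace W"
  shows "dim W \<le> dim {w \<in> W. \<forall>b\<in>B. \<omega> w b = 0} + card B"
  using assms(1)
proof (induction B rule: finite_induct)
  case (insert b B)
  let ?V = "{w \<in> W. \<forall>b\<in>B. \<omega> w b = 0}"
  let ?V' = "{w \<in> W. \<forall>b\<in>insert b B. \<omega> w b = 0}"
  have "dim ?V \<le> dim ?V' + 1"
  proof (cases "\<forall>w\<in>?V. \<omega> w b = 0")
    case True
    then have "?V = ?V'" by auto
    then show ?thesis by simp
  next
    case False
    then obtain x where x: "x \<in> ?V" "\<omega> x b \<noteq> 0" by blast
    have "?V \<subseteq> span (insert x ?V')"
    proof
      fix w assume w: "w \<in> ?V"
      \<comment> \<open>The coefficient is chosen to give \<open>\<omega> y b = 0\<close>.\<close>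
      define y where "y = w + scale (- \<omega> w b / \<omega> x b) x"
      have "y \<in> ?V'"
        using w x assms(2)
        by (auto simp: y_def form_add_left form_scale_left subspace_def simp del: scale_minus_left)
      then have "y - scale (- \<omega> w b / \<omega> x b) x \<in> span (insert x ?V')"
        by (intro span_diff span_scale span_base) auto
      then show "w \<in> span (insert x ?V')" by (simp add: y_def)
    qed
    then have "dim ?V \<le> dim (insert x ?V')" by (rule dim_mono)
    also have "\<dots> \<le> dim ?V' + 1" by (simp add: dim_insert)
    finally show ?thesis .
  qed
  then show ?case using insert by simp
qed simp

text \<open>The vector \<open>x\<close> is orthogonal to itself since the form is alternating. This
  serves both to exploit maximality of a Lagrangian ideal and to pass from a hyperplane to the whole
  space.\<close>

lemma isotropic_insert:
  assumes "isotropic U" "\<And>u. u \<in> U \<Longrightarrow> \<omega> x u = 0"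
  shows "isotropic (span (insert x U))"
proof -
  have 1: "\<omega> u v = 0" if "u \<in> insert x U" "v \<in> insert x U" for u v
    using that assms form_alternating form_eq_zero_commute unfolding isotropic_def by (metis insertE)
  have 2: "\<omega> u v = 0" if "u \<in> insert x U" "v \<in> span (insert x U)" for u v
    using 1 that form_span_zero by blast
  have "\<omega> u v = 0" if "u \<in> span (insert x U)" "v \<in> span (insert x U)" for u v
    using 2 that form_span_zero[of "insert x U" v u] form_eq_zero_commute by blast
  then show ?thesis by (simp add: isotropic_def)
qed

text \<open>Extend a basis \<open>A\<close> of \<open>U\<close> to \<open>?B\<close>. A vector of
  \<open>U\<close> orthogonal to \<open>?B - A\<close> is orthogonal to everything, hence zero, so
  the \<open>dim UNIV - dim U\<close> equations from \<open>?B - A\<close> must cut \<open>U\<close>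
  down to 0.\<close>

lemma dim_isotropic:
  assumes "isotropic U"
  shows "2 * dim U \<le> dim UNIV"
proof -
  obtain A where A: "A \<subseteq> U" "independent A" "U \<subseteq> span A" "card A = dim U"
    using basis_exists[of U] by metis
  let ?B = "extend_basis A"
  have B: "independent ?B" "span ?B = UNIV" "A \<subseteq> ?B"
    using A(2) by (rule independent_extend_basis span_extend_basis extend_basis_superset)+
  have finB: "finite ?B" using B(1) by (rule finiteI_independent)
  have card: "card ?B = dim UNIV" using B dim_eq_card[of ?B UNIV] by simp
  have "u = 0" if "u \<in> U" "\<forall>b\<in>?B - A. \<omega> u b = 0" for u
  proof (rule form_nondegenerate)
    fix v
    have "\<omega> u b = 0" if "b \<in> ?B" for b
      using assms A(1) that \<open>u \<in> U\<close> \<open>\<forall>b\<in>?B - A. \<omega> u b = 0\<close> unfolding isotropic_def by blast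
    then show "\<omega> u v = 0" using form_span_zero[of ?B u v] B(2) by blast
  qed
  then have "{u \<in> U. \<forall>b\<in>?B - A. \<omega> u b = 0} \<subseteq> {0}" by blast
  then have "dim {u \<in> U. \<forall>b\<in>?B - A. \<omega> u b = 0} = 0" by (rule dim_eq_0[THEN iffD2])
  then have "dim U \<le> card (?B - A)"
    using dim_le_dim_orthogonal[of "?B - A" U] finB assms
    unfolding isotropic_def by (metis add_0 finite_Diff)
  moreover have "card (?B - A) = card ?B - card A" "card A \<le> card ?B"
    using B(3) finB by (simp_all add: card_Diff_subset finite_subset card_mono)
  ultimately show ?thesis using card A(4) by simp
qed

text \<open>By maximality the orthogonal of \<open>I\<close> lies in \<open>I\<close>, and its
  codimension is at most \<open>dim I\<close>.\<close>

lemma dim_lagrangian_ideal: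
  assumes "lagrangian_ideal I"
  shows "dim UNIV \<le> 2 * dim I"
proof -
  have iso: "isotropic I" and mx: "\<And>W. isotropic W \<Longrightarrow> I \<subseteq> W \<Longrightarrow> W = I"
    using assms by (auto simp: lagrangian_ideal_def)
  obtain A where A: "A \<subseteq> I" "independent A" "I \<subseteq> span A" "card A = dim I"
    using basis_exists[of I] by metis
  have "{w \<in> UNIV. \<forall>b\<in>A. \<omega> w b = 0} \<subseteq> I"
  proof
    fix x assume "x \<in> {w \<in> UNIV. \<forall>b\<in>A. \<omega> w b = 0}"
    then have "\<omega> x u = 0" if "u \<in> I" for u using that A(3) form_span_zero by blast
    then have "span (insert x I) = I"
      using isotropic_insert[OF iso] mx by (auto intro: span_base)
    then show "x \<in> I" by (metis insertI1 span_base)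
  qed
  then have "dim {w \<in> UNIV. \<forall>b\<in>A. \<omega> w b = 0} \<le> dim I" by (rule dim_subset)
  then show ?thesis
    using dim_le_dim_orthogonal[OF finiteI_independent[OF A(2)] subspace_UNIV] A(4) by linarith
qed

text \<open>Closedness moves one bracket across the form: for \<open>u = [a, b]\<close>, the pairing
  with \<open>v\<close> reduces to that of \<open>b\<close> with \<open>[v, a]\<close>, where the
  index sum is unchanged, and that of \<open>a\<close> with \<open>[b, v]\<close>, which is zero by
  depth. At \<open>i = 0\<close> the right argument is already zero.\<close>

lemma form_descending_central:
  assumes "descending_central m = {0}" "m \<le> i + j"
    and "u \<in> descending_central i" "v \<in> descending_central j"
  shows "\<omega> u v = 0"
  using assms(2-4)
proof (induction i arbitrary: j u v)
  case 0
  then show ?case using assms(1) descending_central_antimono[of m j] form_eq_zero_commute by auto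
next
  case (Suc i)
  have "\<omega> v (bracket a b) = 0" if b: "b \<in> descending_central i" for a b
  proof -
    have "bracket b v \<in> descending_central m"
      using bracket_descending_central_both[OF b Suc.prems(3)] Suc.prems(1)
        descending_central_antimono[of m "i + j + 1"] by auto
    then have "bracket b v = 0" using assms(1) by simp
    moreover have "\<omega> b (bracket v a) = 0"
      using Suc.IH[OF _ b bracket_descending_central_left[OF Suc.prems(3)]] Suc.prems(1) by simp
    ultimately show ?thesis
      using form_closed[of a b v] form_eq_zero_commute[of v] form_eq_zero_commute[of b] by simp
  qed
  then have "\<omega> v u = 0"
    using form_span_zero[of "{bracket a b |a b. b \<in> descending_central i}" v u] Suc.prems(2)
    by (auto simp: descending_central.simps(2))
  then show ?case using form_eq_zero_commute by blast
qed

section \<open>The Lagrangian ideal and its uniqueness\<close>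

lemma lagrangian_ideal_descending_central:
  assumes filiform "dim UNIV = 2 * l" "l \<ge> 2"
  shows "lagrangian_ideal (descending_central (l - 1))"
proof -
  let ?C = descending_central
  have nil: nilpotent and top: "?C (2 * l - 1) = {0}" and ne: "?C (2 * l - 2) \<noteq> {0}"
    using assms by (auto simp: filiform_def has_nilpotency_class_def numeral_2_eq_2)
  \<comment> \<open>Needed at \<open>i = l\<close> and \<open>i = l - 1\<close>, giving dimensions
    at least \<open>l - 1\<close> and \<open>l\<close>.\<close>
  have lower: "2 * l - 1 \<le> dim (?C i) + i" if "i \<le> l" for i
    using dim_descending_central_ge[OF nil ne, of i] that assms(3) by linarith
  have sub0: "0 \<in> ?C i" for i by (rule subspace_0[OF subspace_descending_central])
  have "\<not> ?C (l - 1) \<subseteq> {0}"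
    using ne descending_central_antimono[of "l - 1" "2 * l - 2"] assms(3) sub0 by fastforce
  then have "dim (span ({0} \<union> ?C (l - 1))) + (l - 1) + 1 \<le> 2 * l"
    using dim_ideal_plus_central[OF nil lie_ideal_zero, of "l - 1"] assms(2,3) by simp
  moreover have "{0} \<union> ?C (l - 1) = ?C (l - 1)" using sub0 by auto
  ultimately have up: "dim (?C (l - 1)) \<le> l" using assms(3) by simp
  have le: "?C l \<subseteq> ?C (l - 1)" by (rule descending_central_antimono) simp
  have isoC: "isotropic (?C l)"
    unfolding isotropic_def
    using subspace_descending_central form_descending_central[OF top, of l l] by auto
  \<comment> \<open>The index sum \<open>2 * l - 2\<close> is one too small to make
    \<open>?C (l - 1)\<close> isotropic directly. It suffices for pairing with \<open>?C l\<close>,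
    and \<open>?C (l - 1)\<close> has at most one further generator \<open>x\<close>.\<close>
  have iso: "isotropic (?C (l - 1))"
  proof (cases "?C l = ?C (l - 1)")
    case False
    then obtain x where x: "x \<in> ?C (l - 1)" "x \<notin> ?C l" using le by blast
    have "x \<notin> span (?C l)" using x(2) subspace_descending_central span_eq_iff by metis
    then have "dim (span (insert x (?C l))) = dim (?C l) + 1" by (simp add: dim_insert)
    moreover have "span (insert x (?C l)) \<subseteq> ?C (l - 1)"
      using x le subspace_descending_central by (intro span_minimal) auto
    ultimately have "span (insert x (?C l)) = ?C (l - 1)"
      using lower[of l] up subspace_descending_central assms(3)
      by (intro subspace_dim_equal) auto
    moreover have "\<omega> x u = 0" if "u \<in> ?C l" for u
      using form_descending_central[OF top _ x(1) that] by simp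
    ultimately show ?thesis using isotropic_insert[OF isoC] by metis
  qed (use isoC in simp)
  have "W = ?C (l - 1)" if W: "isotropic W" "?C (l - 1) \<subseteq> W" for W
  proof -
    have "dim W \<le> dim (?C (l - 1))"
      using dim_isotropic[OF W(1)] assms(2,3) lower[of "l - 1"] by simp
    then show ?thesis
      using subspace_dim_equal[OF subspace_descending_central _ W(2)] W(1)
      by (auto simp: isotropic_def)
  qed
  then show ?thesis using iso lie_ideal_descending_central by (simp add: lagrangian_ideal_def)
qed

lemma lagrangian_ideal_unique:
  assumes filiform "dim UNIV = 2 * l" "l \<ge> 2" "lagrangian_ideal I"
  shows "I = descending_central (l - 1)"
proof -
  let ?C = "descending_central (l - 1)"
  have I: "lie_ideal I" "isotropic I" using assms(4) by (auto simp: lagrangian_ideal_def)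
  have nil: nilpotent using assms(1) by (simp add: filiform_def)
  have "?C \<subseteq> I"
  proof (rule ccontr)
    assume no: "\<not> ?C \<subseteq> I"
    \<comment> \<open>Without containment, \<open>I + ?C\<close> would have codimension at least
      \<open>l\<close>, while \<open>dim I\<close> is at least \<open>l\<close>; then adding
      \<open>?C\<close> to \<open>I\<close> would enlarge nothing.\<close>
    have "dim (span (I \<union> ?C)) \<le> dim I"
      using dim_ideal_plus_central[OF nil I(1) _ no] dim_lagrangian_ideal[OF assms(4)] assms(2,3)
      by linarith
    then have "I = span (I \<union> ?C)"
      using I(1) by (intro subspace_dim_equal) (auto simp: lie_ideal_def intro: span_base)
    then show False using no by (metis Un_upper2 span_superset subset_trans)
  qed
  \<comment> \<open>Now \<open>I\<close> is an isotropic space containing the maximal isotropic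
    \<open>?C\<close>.\<close>
  then show ?thesis
    using lagrangian_ideal_descending_central[OF assms(1-3)] I(2) by (auto simp: lagrangian_ideal_def)
qed

end

theorem theorem8p5:
  fixes scale :: "'k::field_char_0 \<Rightarrow> 'v::ab_group_add \<Rightarrow> 'v"
    and bracket :: "'v \<Rightarrow> 'v \<Rightarrow> 'v"
    and \<omega> :: "'v \<Rightarrow> 'v \<Rightarrow> 'k"
    and l :: nat
  assumes "symplectic_lie_algebra scale bracket \<omega>"
    and "lie_algebra.filiform scale bracket"
    and "vector_space.dim scale (UNIV :: 'v set) = 2 * l"
    and "l \<ge> 2"
  shows "symplectic_lie_algebra.lagrangian_ideal scale bracket \<omega>
           (lie_algebra.descending_central scale bracket (l - 1)) \<and>
         (\<forall>I. symplectic_lie_algebra.lagrangian_ideal scale bracket \<omega> I \<longrightarrow>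
           I = lie_algebra.descending_central scale bracket (l - 1))"
proof -
  interpret symplectic_lie_algebra scale bracket \<omega> by fact
  show ?thesis
    using lagrangian_ideal_descending_central[OF assms(2-4)] lagrangian_ideal_unique[OF assms(2-4)]
    by blast
qed

end
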